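(* Let $\mathcal{G}$ be a finite connected graph and consider the continuous-time Markov jump process on its vertices with transition rates $k(x,y)=\psi(x,y)\,e^{S(x,y)/2}$, where $\psi(x,y)=\psi(y,x)\ge 0$ is nonzero exactly when $\{x,y\}$ is an edge of $\mathcal{G}$, and $S(x,y)=-S(y,x)$ is real. Let $\rho^s$ be its unique stationary probability distribution. Then for every vertex $x$, $$\frac{1}{\rho^s(x)}=\sum_{y}\Big\langle e^{-S_{\mathcal{T}}(y\to x)}\Big\rangle_x ,$$ where the sum is over all vertices $y$ of $\mathcal{G}$ and $\langle\cdot\rangle_x$ is the expectation over spanning trees $\mathcal{T}$ in the tree-ensemble attached to $x$.
   Context: The stationary distribution $\rho^s>0$ is the unique normalized solution of $\sum_y [k(x,y)\rho(x)-k(y,x)\rho(y)]=0$ for all $x$. A spanning tree $\mathcal{T}$ of $\mathcal{G}$ is a subgraph that is a tree containing all vertices. $\mathcal{T}_x$ denotes the in-tree to $x$, obtained by orienting every edge of $\mathcal{T}$ towards $x$. Its weight is $\omega_{\mathcal{T}}(x)=\prod_{(z,z')\in\mathcal{T}_x}k(z,z')$, the product over directed edges of $\mathcal{T}_x$, and $w(x)=\sum_{\mathcal{T}}\omega_{\mathcal{T}}(x)$, the sum over all spanning trees of $\mathcal{G}$. The tree-ensemble attached to $x$ is the probability measure on spanning trees with $\langle g(\mathcal{T})\rangle_x=\frac{1}{w(x)}\sum_{\mathcal{T}}g(\mathcal{T})\,\omega_{\mathcal{T}}(x)$. For vertices $y,x$ and a spanning tree $\mathcal{T}$, $S_{\mathcal{T}}(y\to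 x)$ is the sum of $S(u,v)=\log\frac{k(u,v)}{k(v,u)}$ over the directed edges $(u,v)$ of the unique path in $\mathcal{T}$ from $y$ to $x$ (in particular $S_{\mathcal{T}}(x\to x)=0$). *)

theory Defs
  imports Complex_Main "Graph_Theory.Digraph_Component"
begin

text \<open>
  Undirected simple graphs are symmetric loop-free pair digraphs (\<^locale>\<open>pair_graph\<close>): the
  edge \<open>{u, v}\<close> is represented by the two arcs \<open>(u, v)\<close> and \<open>(v, u)\<close>.

  The predicates \<^const>\<open>tree\<close> and \<^const>\<open>spanning_tree\<close> of \<^theory>\<open>Graph_Theory.Digraph_Component\<close>
  exclude directed cycles and hence count \<open>u, v, u\<close> as a cycle. For undirected trees, only cycles
  of length at least 3 must be excluded.
\<close>

definition undirected_tree :: "'a pair_pre_digraph \<Rightarrow> bool" where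
  "undirected_tree T \<longleftrightarrow>
     pair_graph T \<and> Digraph_Component.connected (with_proj T) \<and>
     \<not> (\<exists>p. pre_digraph.cycle (with_proj T) p \<and> 3 \<le> length p)"

definition spanning_trees :: "'a pair_pre_digraph \<Rightarrow> 'a pair_pre_digraph set" where
  "spanning_trees G = {T. undirected_tree T \<and> spanning (with_proj T) (with_proj G)}"

text \<open>An edge \<open>{u, v}\<close> of \<open>T\<close> is oriented as \<open>(u, v)\<close> if the path from \<open>u\<close> to \<open>x\<close> starts with it.\<close>

definition in_tree :: "'a pair_pre_digraph \<Rightarrow> 'a \<Rightarrow> ('a \<times> 'a) set" where
  "in_tree T x = {(u, v) \<in> parcs T. \<exists>p. pre_digraph.apath (with_proj T) u ((u, v) # p) x}"

definition tree_path :: "'a pair_pre_digraph \<Rightarrow> 'a \<Rightarrow> 'a \<Rightarrow> ('a \<times> 'a) list" where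
  "tree_path T y x = (THE p. pre_digraph.apath (with_proj T) y p x)"

definition tree_weight :: "('a \<Rightarrow> 'a \<Rightarrow> real) \<Rightarrow> 'a pair_pre_digraph \<Rightarrow> 'a \<Rightarrow> real" where
  "tree_weight k T x = (\<Prod>(z, z') \<in> in_tree T x. k z z')"

definition total_tree_weight :: "('a \<Rightarrow> 'a \<Rightarrow> real) \<Rightarrow> 'a pair_pre_digraph \<Rightarrow> 'a \<Rightarrow> real" where
  "total_tree_weight k G x = (\<Sum>T \<in> spanning_trees G. tree_weight k T x)"

definition tree_expectation ::
  "('a \<Rightarrow> 'a \<Rightarrow> real) \<Rightarrow> 'a pair_pre_digraph \<Rightarrow> 'a \<Rightarrow> ('a pair_pre_digraph \<Rightarrow> real) \<Rightarrow> real" where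
  "tree_expectation k G x g =
     1 / total_tree_weight k G x * (\<Sum>T \<in> spanning_trees G. g T * tree_weight k T x)"

definition tree_entropy :: "('a \<Rightarrow> 'a \<Rightarrow> real) \<Rightarrow> 'a pair_pre_digraph \<Rightarrow> 'a \<Rightarrow> 'a \<Rightarrow> real" where
  "tree_entropy k T y x = (\<Sum>(u, v) \<leftarrow> tree_path T y x. ln (k u v / k v u))"

definition jump_rate :: "('a \<Rightarrow> 'a \<Rightarrow> real) \<Rightarrow> ('a \<Rightarrow> 'a \<Rightarrow> real) \<Rightarrow> 'a \<Rightarrow> 'a \<Rightarrow> real" where
  "jump_rate \<psi> S x y = \<psi> x y * exp (S x y / 2)"

definition stationary_distribution :: "'a set \<Rightarrow> ('a \<Rightarrow> 'a \<Rightarrow> real) \<Rightarrow> ('a \<Rightarrow> real) \<Rightarrow> bool" where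
  "stationary_distribution V k \<rho> \<longleftrightarrow>
     (\<forall>x\<in>V. 0 \<le> \<rho> x) \<and> (\<Sum>x\<in>V. \<rho> x) = 1 \<and>
     (\<forall>x\<in>V. (\<Sum>y\<in>V. k x y * \<rho> x - k y x * \<rho> y) = 0)"

end

theory Submission
  imports Defs
begin

text \<open>
  Reversing the arcs on the path from \<open>y\<close> to \<open>x\<close> turns the in-tree to \<open>x\<close> into the in-tree to \<open>y\<close>
  and multiplies the weight by \<open>exp (- S\<^sub>T(y \<rightarrow> x))\<close>, so the right-hand side is \<open>(\<Sum>y. w y) / w x\<close>,
  and the claim is the Markov chain tree theorem \<open>\<rho> = w / (\<Sum>y. w y)\<close>.

  For the balance equation of \<open>w\<close> at \<open>x\<close>, add the arc \<open>(y, x)\<close> to an in-tree to a neighbour \<open>y\<close> of \<open>x\<close>.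
  The result has one cycle, which passes through \<open>x\<close>; if it leaves \<open>x\<close> by the arc \<open>(x, z)\<close>,
  deleting that arc leaves an in-tree to \<open>x\<close>. This matches the pairs (in-tree to \<open>y\<close>, arc \<open>(y, x)\<close>)
  with the pairs (in-tree to \<open>x\<close>, arc \<open>(x, z)\<close>), and matching pairs have the same product of rates.
  On undirected trees it is the involution \<open>(y, E) \<mapsto> (z, E - {x, z} + {x, y})\<close>.
\<close>

section \<open>Trees as symmetric relations\<close>

definition delete_edge :: "('a \<times> 'a) set \<Rightarrow> 'a \<Rightarrow> 'a \<Rightarrow> ('a \<times> 'a) set" where
  "delete_edge E u v = E - {(u, v), (v, u)}"

definition add_edge :: "('a \<times> 'a) set \<Rightarrow> 'a \<Rightarrow> 'a \<Rightarrow> ('a \<times> 'a) set" where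
  "add_edge E u v = E \<union> {(u, v), (v, u)}"

lemma sym_delete_edge: "sym E \<Longrightarrow> sym (delete_edge E u v)"
  by (auto simp: sym_def delete_edge_def)

lemma sym_add_edge: "sym E \<Longrightarrow> sym (add_edge E u v)"
  by (auto simp: sym_def add_edge_def)

lemma add_edge_delete_edge: "sym E \<Longrightarrow> (u, v) \<in> E \<Longrightarrow> add_edge (delete_edge E u v) u v = E"
  by (auto simp: sym_def add_edge_def delete_edge_def)

lemma delete_edge_commute: "delete_edge (delete_edge E u v) x y = delete_edge (delete_edge E x y) u v"
  by (auto simp: delete_edge_def)

lemma delete_edge_swap: "delete_edge E u v = delete_edge E v u"
  by (auto simp: delete_edge_def)

text \<open>A path can be shortened until it crosses the new edge at most once. Connectivity is
  compared below by writing two relations as a common remainder plus one edge each.\<close>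

lemma rtrancl_add_edge:
  "(a, b) \<in> (add_edge R x y)\<^sup>* \<longleftrightarrow>
     (a, b) \<in> R\<^sup>* \<or> (a, x) \<in> R\<^sup>* \<and> (y, b) \<in> R\<^sup>* \<or> (a, y) \<in> R\<^sup>* \<and> (x, b) \<in> R\<^sup>*"
proof -
  have "add_edge R x y = insert (x, y) (insert (y, x) R)"
    by (auto simp: add_edge_def)
  then show ?thesis
    by (auto simp: rtrancl_insert intro: rtrancl_trans)
qed

lemma rtrancl_sym: "sym R \<Longrightarrow> (a, b) \<in> R\<^sup>* \<Longrightarrow> (b, a) \<in> R\<^sup>*"
  by (meson sym_rtrancl symD)

lemma rtrancl_delete_edge: "(a, b) \<in> (delete_edge R x y)\<^sup>* \<Longrightarrow> (a, b) \<in> R\<^sup>*"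
  by (rule rtrancl_mono[THEN subsetD]) (auto simp: delete_edge_def)

text \<open>A path-free form of the in-tree to \<open>x\<close>: on a tree, an arc points towards
  \<open>x\<close> if its head still reaches \<open>x\<close> once the edge is cut. The agreement
  with \<open>in_tree\<close> is \<open>in_tree_eq_arcs_towards\<close>.\<close>

definition arcs_towards :: "('a \<times> 'a) set \<Rightarrow> 'a \<Rightarrow> ('a \<times> 'a) set" where
  "arcs_towards E x = {(u, v) \<in> E. (v, x) \<in> (delete_edge E u v)\<^sup>*}"

text \<open>Acyclicity is expressed by every edge being a bridge, which keeps edge exchange a matter
  of reachability. Since reachability is reflexive, \<open>bridge\<close> also excludes
  loops.\<close>

locale edge_tree =
  fixes V :: "'a set" and E :: "('a \<times> 'a) set"
  assumes edges_subset: "E \<subseteq> V \<times> V"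
    and sym_edges: "sym E"
    and edges_connected: "u \<in> V \<Longrightarrow> v \<in> V \<Longrightarrow> (u, v) \<in> E\<^sup>*"
    and bridge: "(u, v) \<in> E \<Longrightarrow> (u, v) \<notin> (delete_edge E u v)\<^sup>*"
begin

lemma edge_reverse: "(u, v) \<in> E \<Longrightarrow> (v, u) \<in> E"
  using sym_edges by (auto dest: symD)

lemma sides_disjoint:
  assumes "(u, v) \<in> E" "(u, w) \<in> (delete_edge E u v)\<^sup>*"
  shows "(v, w) \<notin> (delete_edge E u v)\<^sup>*"
  using assms bridge sym_delete_edge[OF sym_edges] rtrancl_sym rtrancl_trans by metis

lemma arcs_towards_not_reverse: "(u, v) \<in> arcs_towards E x \<Longrightarrow> (v, u) \<notin> arcs_towards E x"
  using sides_disjoint by (auto simp: arcs_towards_def delete_edge_swap[of E v u])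

lemma no_arc_towards_self: "(x, v) \<notin> arcs_towards E x"
  using sides_disjoint[of x v x] by (auto simp: arcs_towards_def)

lemma arc_towards_target: "(u, x) \<in> E \<Longrightarrow> (u, x) \<in> arcs_towards E x"
  by (auto simp: arcs_towards_def)

text \<open>Induction along a walk from \<open>u\<close> to \<open>x\<close>, moving the target.
  Each time the walk leaves \<open>u\<close>, the arc just taken becomes the witness; a step not
  touching \<open>u\<close> survives cutting an edge at \<open>u\<close>.\<close>

lemma arc_towards_exists:
  assumes "u \<in> V" "x \<in> V" "u \<noteq> x"
  shows "\<exists>v. (u, v) \<in> arcs_towards E x"
proof -
  have "x = u \<or> (\<exists>v. (u, v) \<in> arcs_towards E x)"
    using edges_connected[OF assms(1,2)]
  proof induction
    case (step w w')
    consider "w' = u" | "w = u" "w' \<noteq> u" | "w \<noteq> u" "w' \<noteq> u" by blast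
    then show ?case
    proof cases
      case 2
      then show ?thesis using step.hyps arc_towards_target by blast
    next
      case 3
      with step.IH obtain v where v: "(u, v) \<in> E" "(v, w) \<in> (delete_edge E u v)\<^sup>*"
        by (auto simp: arcs_towards_def)
      moreover have "(w, w') \<in> delete_edge E u v"
        using step.hyps 3 by (auto simp: delete_edge_def)
      ultimately show ?thesis
        by (auto simp: arcs_towards_def intro: rtrancl_into_rtrancl)
    qed simp
  qed simp
  with assms show ?thesis by simp
qed

lemma arc_towards_unique:
  assumes v: "(u, v) \<in> arcs_towards E x" and v': "(u, v') \<in> arcs_towards E x"
  shows "v = v'"
proof (rule ccontr)
  assume neq: "v \<noteq> v'"
  \<comment> \<open>Cutting one of the two edges leaves \<open>R\<close> plus the other. As both are
    bridges, \<open>v\<close> and \<open>v'\<close> must each reach \<open>x\<close> within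
    \<open>R\<close>; they are then joined in \<open>R\<close>, and {u, v'} completes a way from
    \<open>u\<close> to \<open>v\<close> around {u, v}.\<close>
  define R where "R = delete_edge (delete_edge E u v) u v'"
  have symR: "sym R" unfolding R_def by (intro sym_delete_edge sym_edges)
  have uv: "(u, v) \<in> E" "(u, v') \<in> E" using assms by (auto simp: arcs_towards_def)
  have ne: "u \<noteq> v" "u \<noteq> v'" using uv bridge by blast+
  have 1: "delete_edge E u v = add_edge R u v'"
    unfolding R_def using uv neq ne
    by (subst add_edge_delete_edge) (auto simp: sym_delete_edge sym_edges, auto simp: delete_edge_def)
  have 2: "delete_edge E u v' = add_edge R u v"
    unfolding R_def delete_edge_commute[of E u v] using uv neq ne
    by (subst add_edge_delete_edge) (auto simp: sym_delete_edge sym_edges, auto simp: delete_edge_def)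
  have "(v, x) \<in> (add_edge R u v')\<^sup>*" "(v', x) \<in> (add_edge R u v)\<^sup>*"
    using assms 1 2 by (auto simp: arcs_towards_def)
  moreover have "(u, v) \<notin> (add_edge R u v')\<^sup>*" "(u, v') \<notin> (add_edge R u v)\<^sup>*"
    using bridge[OF uv(1)] bridge[OF uv(2)] 1 2 by simp_all
  ultimately show False
    unfolding rtrancl_add_edge using rtrancl_sym[OF symR] by (meson rtrancl.rtrancl_refl rtrancl_trans)
qed

end

section \<open>Exchanging one edge of a tree\<close>

locale tree_exchange = edge_tree +
  fixes x y z
  assumes x_in: "x \<in> V" and y_in: "y \<in> V" and xz: "(x, z) \<in> arcs_towards E y"
begin

text \<open>Here \<open>z\<close> is the vertex after \<open>x\<close> on the way to
  \<open>y\<close>. The degenerate case \<open>y = z\<close> is included and gives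
  \<open>E' = E\<close>.\<close>

definition E' where "E' = add_edge (delete_edge E x z) x y"

lemma xz_edge: "(x, z) \<in> E"
  using xz by (simp add: arcs_towards_def)

lemma z_reaches_y: "(z, y) \<in> (delete_edge E x z)\<^sup>*"
  using xz by (simp add: arcs_towards_def)

lemma x_not_reaches: "(x, y) \<notin> (delete_edge E x z)\<^sup>*" "(x, z) \<notin> (delete_edge E x z)\<^sup>*"
  using sides_disjoint[OF xz_edge] z_reaches_y bridge[OF xz_edge] by blast+

text \<open>An edge {x, y} would itself be the arc from \<open>x\<close> towards \<open>y\<close>,
  and that arc is unique.\<close>

lemma xy_notin: "y \<noteq> z \<Longrightarrow> (x, y) \<notin> E"
  using arc_towards_target arc_towards_unique xz by blast

lemma sym_E': "sym E'"
  unfolding E'_def by (intro sym_add_edge sym_delete_edge sym_edges)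

text \<open>Together with \<open>delete_E\<close>, this writes both trees without {u, v} as the same
  remainder plus one edge: {x, y} for \<open>E'\<close> and {x, z} for \<open>E\<close>.\<close>

lemma delete_E':
  assumes "(u, v) \<in> E" "{u, v} \<noteq> {x, z}"
  shows "delete_edge E' u v = add_edge (delete_edge (delete_edge E u v) x z) x y"
proof -
  have "(u, v) \<noteq> (x, y)" "(u, v) \<noteq> (y, x)"
    using assms xy_notin edge_reverse by blast+
  then show ?thesis
    by (auto simp: E'_def add_edge_def delete_edge_def)
qed

lemma delete_E:
  assumes "{u, v} \<noteq> {x, z}"
  shows "delete_edge E u v = add_edge (delete_edge (delete_edge E u v) x z) x z"
  by (subst add_edge_delete_edge)
     (use assms xz_edge in \<open>auto simp: sym_delete_edge sym_edges, auto simp: delete_edge_def doubleton_eq_iff\<close>)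

lemma delete_xy_E': "delete_edge E' x y = delete_edge E x z"
proof (cases "y = z")
  case False
  then have "(x, y) \<notin> E" "(y, x) \<notin> E" using xy_notin edge_reverse by blast+
  then show ?thesis by (auto simp: E'_def add_edge_def delete_edge_def)
next
  case True
  then have "E' = E"
    unfolding E'_def by (simp add: add_edge_delete_edge sym_edges xz_edge)
  with True show ?thesis by simp
qed

lemma exchange_back: "add_edge (delete_edge E' x y) x z = E"
  by (simp add: delete_xy_E' add_edge_delete_edge sym_edges xz_edge)

lemma xy_towards: "(x, y) \<in> arcs_towards E' z"
  using rtrancl_sym[OF sym_delete_edge[OF sym_edges] z_reaches_y]
  by (auto simp: arcs_towards_def delete_xy_E') (simp add: E'_def add_edge_def)

text \<open>Cutting {x, z} separates \<open>x\<close> from the component of \<open>z\<close>, which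
  contains \<open>y\<close>; the edge {x, y} joins the two components again.\<close>

lemma edge_tree_E': "edge_tree V E'"
proof
  show "E' \<subseteq> V \<times> V"
    using edges_subset x_in y_in by (auto simp: E'_def add_edge_def delete_edge_def)
  show "sym E'" by (rule sym_E')
  have xz': "(x, z) \<in> E'\<^sup>*"
    unfolding E'_def rtrancl_add_edge
    using rtrancl_sym[OF sym_delete_edge[OF sym_edges] z_reaches_y] by blast
  have "E \<subseteq> E'\<^sup>*"
  proof
    fix e assume "e \<in> E"
    then consider "e \<in> {(x, z), (z, x)}" | "e \<in> E'"
      by (auto simp: E'_def add_edge_def delete_edge_def)
    then show "e \<in> E'\<^sup>*"
      using xz' rtrancl_sym[OF sym_E'] by cases auto
  qed
  then have "E\<^sup>* \<subseteq> E'\<^sup>*" by (rule rtrancl_subset_rtrancl)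
  then show "(u, v) \<in> E'\<^sup>*" if "u \<in> V" "v \<in> V" for u v
    using edges_connected that by blast
  show "(u, v) \<notin> (delete_edge E' u v)\<^sup>*" if uv: "(u, v) \<in> E'" for u v
  proof (cases "(u, v) \<in> {(x, y), (y, x)}")
    case True
    then show ?thesis
      using x_not_reaches rtrancl_sym[OF sym_delete_edge[OF sym_edges]]
      by (auto simp: delete_xy_E' delete_edge_swap[of E' y x])
  next
    case False
    define R where "R = delete_edge (delete_edge E u v) x z"
    have symR: "sym R" unfolding R_def by (intro sym_delete_edge sym_edges)
    have E: "(u, v) \<in> E" "{u, v} \<noteq> {x, z}"
      using uv False by (auto simp: E'_def add_edge_def delete_edge_def doubleton_eq_iff)
    have "(u, v) \<in> delete_edge E x z"
      using E by (auto simp: delete_edge_def)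
    then have D: "delete_edge E x z = add_edge R u v"
      unfolding R_def delete_edge_commute[of E u v] 
      by (subst add_edge_delete_edge) (auto simp: sym_delete_edge sym_edges)
    \<comment> \<open>If \<open>u\<close> and \<open>v\<close> were joined through {x, y}, the two
      halves of that detour together with {u, v} would join \<open>x\<close> to \<open>y\<close> in
      \<open>E\<close> without {x, z}.\<close>
    have 1: "(x, y) \<notin> (add_edge R u v)\<^sup>*"
      using x_not_reaches D by simp
    have "(u, v) \<notin> (delete_edge E u v)\<^sup>*" using bridge E by blast
    then have "(u, v) \<notin> R\<^sup>*"
      unfolding R_def using rtrancl_delete_edge by fastforce
    then have "(u, v) \<notin> (add_edge R x y)\<^sup>*"
      using 1 unfolding rtrancl_add_edge using rtrancl_sym[OF symR] by blast
    then show ?thesis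
      using delete_E' E by (simp add: R_def)
  qed
qed

text \<open>Both sides are the same one-cycle graph: the cycle passes through \<open>x\<close>,
  entering by \<open>(y, x)\<close> and leaving by \<open>(x, z)\<close>.\<close>

lemma arcs_towards_exchange:
  "insert (y, x) (arcs_towards E y) = insert (x, z) (arcs_towards E' x)"
proof -
  interpret T': edge_tree V E' by (rule edge_tree_E')
  have sub: "arcs_towards E y \<subseteq> insert (x, z) (arcs_towards E' x)"
  proof clarify
    fix u v assume uv: "(u, v) \<in> arcs_towards E y" and no: "(u, v) \<notin> arcs_towards E' x"
    then have "(u, v) \<in> E" by (simp add: arcs_towards_def)
    show "u = x \<and> v = z"
    proof (cases "{u, v} = {x, z}")
      case True
      then show ?thesis
        using uv arcs_towards_not_reverse[OF xz] by (auto simp: doubleton_eq_iff)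
    next
      case False
      define R where "R = delete_edge (delete_edge E u v) x z"
      have symR: "sym R" unfolding R_def by (intro sym_delete_edge sym_edges)
      have "(v, y) \<in> (add_edge R x z)\<^sup>*"
        using uv delete_E[OF False] by (auto simp: R_def arcs_towards_def)
      \<comment> \<open>This excludes crossing {x, z} from \<open>z\<close> to \<open>x\<close>. The
        way from \<open>v\<close> to \<open>y\<close> thus either avoids {x, z}, and the new edge
        {x, y} continues it to \<open>x\<close>, or it has already reached \<open>x\<close> before
        crossing.\<close>
      moreover have "(x, y) \<notin> R\<^sup>*"
        using x_not_reaches rtrancl_delete_edge unfolding R_def delete_edge_commute[of E u v] by metis
      ultimately have "(v, x) \<in> (add_edge R x y)\<^sup>*"
        unfolding rtrancl_add_edge using rtrancl_sym[OF symR] by blast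
      moreover have "(u, v) \<in> E'"
        using \<open>(u, v) \<in> E\<close> False by (auto simp: E'_def add_edge_def delete_edge_def)
      ultimately have "(u, v) \<in> arcs_towards E' x"
        using delete_E'[OF \<open>(u, v) \<in> E\<close> False] by (simp add: arcs_towards_def R_def)
      with no show ?thesis by blast
    qed
  qed
  have yx: "(y, x) \<in> arcs_towards E' x"
    by (rule T'.arc_towards_target) (simp add: E'_def add_edge_def)
  show ?thesis
  proof
    show "insert (y, x) (arcs_towards E y) \<subseteq> insert (x, z) (arcs_towards E' x)"
      using sub yx by blast
    \<comment> \<open>A vertex \<open>u\<close> other than \<open>x\<close> and \<open>y\<close> has
      an arc towards \<open>y\<close> in \<open>E\<close>. By the first inclusion it is an arc
      towards \<open>x\<close> in \<open>E'\<close>, where only one arc leaves \<open>u\<close>; so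
      no further arcs occur.\<close>
    show "insert (x, z) (arcs_towards E' x) \<subseteq> insert (y, x) (arcs_towards E y)"
    proof clarify
      fix u v assume uv: "(u, v) \<in> insert (x, z) (arcs_towards E' x)" "(u, v) \<notin> arcs_towards E y"
      then have uv': "(u, v) \<in> arcs_towards E' x" using xz by blast
      then have "u \<in> V" "u \<noteq> x"
        using T'.edges_subset T'.no_arc_towards_self by (auto simp: arcs_towards_def)
      show "u = y \<and> v = x"
      proof (cases "u = y")
        case True
        then show ?thesis using T'.arc_towards_unique uv' yx by blast
      next
        case False
        then obtain w where "(u, w) \<in> arcs_towards E y"
          using arc_towards_exists \<open>u \<in> V\<close> y_in by blast
        with sub \<open>u \<noteq> x\<close> have "(u, w) \<in> arcs_towards E' x" by blast
        with uv' have "w = v" using T'.arc_towards_unique by blast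
        with uv \<open>(u, w) \<in> arcs_towards E y\<close> show ?thesis by blast
      qed
    qed
  qed
qed

end

section \<open>The Markov chain tree theorem\<close>

definition edge_trees :: "'a set \<Rightarrow> ('a \<times> 'a) set \<Rightarrow> ('a \<times> 'a) set set" where
  "edge_trees V A = {E. edge_tree V E \<and> E \<subseteq> A}"

definition arcs_weight :: "('a \<Rightarrow> 'a \<Rightarrow> real) \<Rightarrow> ('a \<times> 'a) set \<Rightarrow> 'a \<Rightarrow> real" where
  "arcs_weight k E x = (\<Prod>(u, v) \<in> arcs_towards E x. k u v)"

definition root_weight :: "('a \<Rightarrow> 'a \<Rightarrow> real) \<Rightarrow> 'a set \<Rightarrow> ('a \<times> 'a) set \<Rightarrow> 'a \<Rightarrow> real" where
  "root_weight k V A x = (\<Sum>E \<in> edge_trees V A. arcs_weight k E x)"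

lemma (in edge_tree) finite_edges: "finite V \<Longrightarrow> finite E"
  using edges_subset by (meson finite_SigmaI finite_subset)

lemma finite_arcs_towards: "finite E \<Longrightarrow> finite (arcs_towards E x)"
  by (rule finite_subset[of _ E]) (auto simp: arcs_towards_def)

text \<open>The product of rates over the one-cycle graph, computed in two ways. The inserted arcs
  are new factors because no arc of an in-tree leaves its root.\<close>

lemma (in tree_exchange) weight_exchange:
  assumes "finite V"
  shows "k y x * arcs_weight k E y = k x z * arcs_weight k E' x"
proof -
  interpret T': edge_tree V E' by (rule edge_tree_E')
  have "k y x * arcs_weight k E y = (\<Prod>(u, v) \<in> insert (y, x) (arcs_towards E y). k u v)"
    using no_arc_towards_self finite_arcs_towards[OF finite_edges[OF assms]]
    by (simp add: arcs_weight_def)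
  also have "\<dots> = k x z * arcs_weight k E' x"
    unfolding arcs_towards_exchange
    using T'.no_arc_towards_self finite_arcs_towards[OF T'.finite_edges[OF assms]]
    by (simp add: arcs_weight_def)
  finally show ?thesis .
qed

text \<open>The exchange with \<open>z = y\<close> keeps the tree and only moves the root across {x,
  y}, which reverses that single arc.\<close>

lemma (in edge_tree) weight_adjacent:
  assumes "finite V" "(x, y) \<in> E"
  shows "k y x * arcs_weight k E y = k x y * arcs_weight k E x"
proof -
  interpret tree_exchange V E x y y
    using assms edges_subset arc_towards_target by unfold_locales auto
  have "E' = E"
    using assms by (simp add: E'_def add_edge_delete_edge sym_edges)
  then show ?thesis using weight_exchange[OF assms(1)] by simp
qed

text \<open>The involution on pairs of a root and a tree. The description of \<open>z\<close> is
  proper when \<open>E\<close> is a tree on \<open>V\<close> and \<open>x\<close>, \<open>y\<close>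
  are distinct vertices of it.\<close>

definition exchange :: "'a \<Rightarrow> 'a \<times> ('a \<times> 'a) set \<Rightarrow> 'a \<times> ('a \<times> 'a) set" where
  "exchange x = (\<lambda>(y, E). let z = (THE z. (x, z) \<in> arcs_towards E y)
     in (z, add_edge (delete_edge E x z) x y))"

lemma (in tree_exchange) exchange_eq: "exchange x (y, E) = (z, E')"
proof -
  have "(THE z. (x, z) \<in> arcs_towards E y) = z"
    using xz arc_towards_unique by blast
  then show ?thesis by (simp add: exchange_def E'_def)
qed

text \<open>In \<open>E'\<close> the way from \<open>x\<close> to \<open>z\<close> starts with
  \<open>(x, y)\<close>, so \<open>y\<close> and \<open>z\<close> swap roles. This makes the
  exchange an involution.\<close>

lemma (in tree_exchange) tree_exchange_E': "tree_exchange V E' x z y"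
proof -
  interpret T': edge_tree V E' by (rule edge_tree_E')
  show ?thesis
    using x_in xz_edge edges_subset xy_towards by unfold_locales auto
qed

lemma (in tree_exchange) exchange_exchange: "exchange x (z, E') = (y, E)"
proof -
  interpret T': tree_exchange V E' x z y by (rule tree_exchange_E')
  show ?thesis using T'.exchange_eq by (simp add: T'.E'_def exchange_back)
qed

lemma (in edge_tree) tree_exchangeI:
  assumes "x \<in> V" "y \<in> V" "x \<noteq> y"
  obtains z where "tree_exchange V E x y z"
proof -
  obtain z where "(x, z) \<in> arcs_towards E y"
    using arc_towards_exists assms by blast
  with assms have "tree_exchange V E x y z"
    by unfold_locales
  then show ?thesis by (rule that)
qed

theorem markov_chain_tree:
  assumes "finite V" "A \<subseteq> V \<times> V" "sym A" "irrefl A" "x \<in> V"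
  shows "(\<Sum>y | (x, y) \<in> A. k y x * root_weight k V A y) =
         (\<Sum>y | (x, y) \<in> A. k x y * root_weight k V A x)"
proof -
  define N where "N = {y. (x, y) \<in> A}"
  define P where "P = N \<times> edge_trees V A"
  have swap: "exchange x p \<in> P \<and> exchange x (exchange x p) = p \<and>
      k x (fst (exchange x p)) * arcs_weight k (snd (exchange x p)) x =
      k (fst p) x * arcs_weight k (snd p) (fst p)" if p: "p \<in> P" for p
  proof -
    obtain y E where yE: "p = (y, E)" "(x, y) \<in> A" "edge_tree V E" "E \<subseteq> A"
      using p by (auto simp: P_def N_def edge_trees_def)
    then have "y \<in> V" "x \<noteq> y" using assms by (auto simp: irrefl_def)
    then obtain z where "tree_exchange V E x y z"
      using edge_tree.tree_exchangeI[OF yE(3)] assms by blast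
    then interpret tree_exchange V E x y z .
    have "E' \<subseteq> A"
      using yE assms by (auto simp: E'_def add_edge_def delete_edge_def dest: symD)
    moreover have "(x, z) \<in> A" using xz_edge yE by blast
    ultimately show ?thesis
      using edge_tree_E' exchange_eq exchange_exchange weight_exchange[OF assms(1), of k]
      by (simp add: yE P_def N_def edge_trees_def)
  qed
  have "(\<Sum>y\<in>N. k y x * root_weight k V A y) =
      (\<Sum>p\<in>P. k (fst p) x * arcs_weight k (snd p) (fst p))"
    by (simp add: P_def root_weight_def sum_distrib_left sum.cartesian_product case_prod_beta)
  \<comment> \<open>\<open>exchange x\<close> is its own inverse on \<open>P\<close>, so it provides
    both witnesses of the bijection.\<close>
  also have "\<dots> = (\<Sum>p\<in>P. k x (fst p) * arcs_weight k (snd p) x)"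
    by (rule sum.reindex_bij_witness[of _ "exchange x" "exchange x"]) (use swap in auto)
  also have "\<dots> = (\<Sum>y\<in>N. k x y * root_weight k V A x)"
    by (simp add: P_def root_weight_def sum_distrib_left sum.cartesian_product case_prod_beta)
  finally show ?thesis by (simp add: N_def)
qed

section \<open>Existence of spanning trees and positivity of the root weights\<close>

lemma finite_edge_trees:
  assumes "finite V" "A \<subseteq> V \<times> V"
  shows "finite (edge_trees V A)"
proof (rule finite_subset)
  show "edge_trees V A \<subseteq> Pow A" by (auto simp: edge_trees_def)
  show "finite (Pow A)" using assms by (simp add: finite_subset)
qed

text \<open>A connected symmetric subrelation with the fewest arcs is a tree: an edge that is not a
  bridge could be deleted without losing connectedness.\<close>

lemma edge_trees_nonempty:
  assumes "finite V" "A \<subseteq> V \<times> V" "sym A" "\<And>u v. u \<in> V \<Longrightarrow> v \<in> V \<Longrightarrow> (u, v) \<in> A\<^sup>*"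
  shows "edge_trees V A \<noteq> {}"
proof -
  define C where "C E \<longleftrightarrow> E \<subseteq> A \<and> sym E \<and> (\<forall>u\<in>V. \<forall>v\<in>V. (u, v) \<in> E\<^sup>*)" for E
  have "C A" using assms by (simp add: C_def)
  then obtain E where E: "C E" and least: "\<And>F. C F \<Longrightarrow> card E \<le> card F"
    using ex_has_least_nat[of C A card] by blast
  have "finite E" using E assms by (meson C_def finite_SigmaI finite_subset)
  have "edge_tree V E"
  proof
    show "E \<subseteq> V \<times> V" "sym E" "u \<in> V \<Longrightarrow> v \<in> V \<Longrightarrow> (u, v) \<in> E\<^sup>*" for u v
      using E assms by (auto simp: C_def)
    show "(u, v) \<notin> (delete_edge E u v)\<^sup>*" if "(u, v) \<in> E" for u v
    proof
      let ?F = "delete_edge E u v"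
      assume uv: "(u, v) \<in> ?F\<^sup>*"
      have sym: "sym ?F" using E by (simp add: C_def sym_delete_edge)
      have "E \<subseteq> ?F\<^sup>*"
      proof
        fix e assume "e \<in> E"
        then consider "e \<in> {(u, v), (v, u)}" | "e \<in> ?F"
          by (auto simp: delete_edge_def)
        then show "e \<in> ?F\<^sup>*"
          using uv rtrancl_sym[OF sym] by cases auto
      qed
      then have "E\<^sup>* \<subseteq> ?F\<^sup>*" by (rule rtrancl_subset_rtrancl)
      moreover have "?F \<subseteq> E" by (auto simp: delete_edge_def)
      ultimately have "C ?F" using E sym by (auto simp: C_def)
      moreover have "card ?F < card E"
        using that \<open>finite E\<close> by (intro psubset_card_mono) (auto simp: delete_edge_def)
      ultimately show False using least by fastforce
    qed
  qed
  then show ?thesis using E by (auto simp: edge_trees_def C_def)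
qed

lemma root_weight_pos:
  assumes "finite V" "A \<subseteq> V \<times> V" "sym A" "\<And>u v. u \<in> V \<Longrightarrow> v \<in> V \<Longrightarrow> (u, v) \<in> A\<^sup>*"
    and "\<And>u v. (u, v) \<in> A \<Longrightarrow> 0 < k u v"
  shows "0 < root_weight k V A x"
  unfolding root_weight_def arcs_weight_def
  using finite_edge_trees[OF assms(1,2)] edge_trees_nonempty[OF assms(1-4)] assms(5)
  by (intro sum_pos prod_pos) (auto simp: edge_trees_def arcs_towards_def)

text \<open>Maximum principle: \<open>\<rho> - c w\<close> is stationary, nonnegative and vanishes somewhere when \<open>c\<close> is the
  least ratio \<open>\<rho> / w\<close>, and its zeros spread along the arcs.\<close>

lemma stationary_unique:
  fixes k :: "'a \<Rightarrow> 'a \<Rightarrow> real"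
  assumes "finite V" "V \<noteq> {}" "A \<subseteq> V \<times> V" "sym A"
    and conn: "\<And>u v. u \<in> V \<Longrightarrow> v \<in> V \<Longrightarrow> (u, v) \<in> A\<^sup>*"
    and k: "\<And>u v. (u, v) \<in> A \<Longrightarrow> 0 < k u v"
    and w: "\<And>x. x \<in> V \<Longrightarrow> 0 < w x"
    and bal_w: "\<And>x. x \<in> V \<Longrightarrow> (\<Sum>y | (x, y) \<in> A. k y x * w y) = (\<Sum>y | (x, y) \<in> A. k x y * w x)"
    and bal_\<rho>: "\<And>x. x \<in> V \<Longrightarrow> (\<Sum>y | (x, y) \<in> A. k y x * \<rho> y) = (\<Sum>y | (x, y) \<in> A. k x y * \<rho> x)"
  obtains c where "\<And>x. x \<in> V \<Longrightarrow> \<rho> x = c * w x"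
proof -
  define c where "c = Min ((\<lambda>x. \<rho> x / w x) ` V)"
  define h where "h x = \<rho> x - c * w x" for x
  have "c \<in> (\<lambda>x. \<rho> x / w x) ` V"
    unfolding c_def by (rule Min_in) (use assms(1,2) in auto)
  then obtain x0 where "x0 \<in> V" "c = \<rho> x0 / w x0" by blast
  then have x0: "x0 \<in> V" "h x0 = 0"
    using w[of x0] by (simp_all add: h_def)
  have h: "0 \<le> h x" if "x \<in> V" for x
  proof -
    have "c \<le> \<rho> x / w x" unfolding c_def by (rule Min_le) (use assms(1) that in auto)
    then show ?thesis using w[OF that] by (simp add: h_def field_simps)
  qed
  have zeros_spread: "h y = 0" if "x \<in> V" "h x = 0" "(x, y) \<in> A" for x y
  proof -
    have fin: "finite {y. (x, y) \<in> A}"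
      by (rule finite_subset[of _ V]) (use assms(1,3) in auto)
    have "(\<Sum>y | (x, y) \<in> A. k y x * h y) = (\<Sum>y | (x, y) \<in> A. k y x * \<rho> y) - c * (\<Sum>y | (x, y) \<in> A. k y x * w y)"
      by (simp add: h_def sum_distrib_left right_diff_distrib sum_subtractf mult.left_commute)
    also have "\<dots> = (\<Sum>y | (x, y) \<in> A. k x y * h x)"
      by (simp add: bal_w bal_\<rho> that(1) h_def sum_distrib_left right_diff_distrib sum_subtractf mult.left_commute)
    \<comment> \<open>The outflow vanishes because \<open>h x = 0\<close>. The inflow is then a
      vanishing sum of nonnegative terms with positive rates, so \<open>h\<close> is zero at every
      neighbour.\<close>
    finally have "(\<Sum>y | (x, y) \<in> A. k y x * h y) = 0" using that by simp
    moreover have "0 \<le> k y x * h y" if "(x, y) \<in> A" for y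
      using that assms(3) h[of y] k[of y x] symD[OF assms(4) that] by auto
    ultimately have "k y x * h y = 0"
      using that fin by (subst (asm) sum_nonneg_eq_0_iff) auto
    moreover have "0 < k y x" using k symD[OF assms(4) that(3)] by blast
    ultimately show ?thesis by simp
  qed
  have "x \<in> V \<and> h x = 0" if "(x0, x) \<in> A\<^sup>*" for x
    using that
  proof induction
    case (step y z)
    then show ?case using zeros_spread assms(3) by blast
  qed (use x0 in simp)
  then have "\<rho> x = c * w x" if "x \<in> V" for x
    using conn[OF x0(1) that] by (simp add: h_def)
  then show ?thesis by (rule that)
qed

section \<open>Undirected trees of the graph library\<close>

lemma (in pair_pre_digraph) pcas_verts_reachable:
  assumes "pcas u p v" "set p \<subseteq> R" "w \<in> set (pawalk_verts u p)"
  shows "(u, w) \<in> R\<^sup>*"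
  using assms by (induction p arbitrary: u) (auto intro: converse_rtrancl_into_rtrancl)

lemma (in pair_wf_digraph) apath_reachable:
  assumes "apath u p v" "set p \<subseteq> R"
  shows "(u, v) \<in> R\<^sup>*"
proof -
  have "v \<in> set (pawalk_verts u p)"
    using assms awlast_of_awalk[of u p v] last_in_set[of "pawalk_verts u p"]
    by (auto simp: apath_def)
  then show ?thesis
    using assms pcas_verts_reachable by (auto simp: apath_def awalk_def)
qed

text \<open>With \<open>R\<close> the arcs left after cutting an edge, this turns reachability into
  a simple path of the whole graph that avoids the edge. Shortening a walk to a path adds no
  arcs.\<close>

lemma (in pair_wf_digraph) reachable_apath_subset:
  assumes "(u, v) \<in> R\<^sup>*" "R \<subseteq> parcs G" "v \<in> pverts G"
  obtains p where "apath u p v" "set p \<subseteq> R"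
proof -
  have "\<exists>p. awalk u p v \<and> set p \<subseteq> R"
    using assms(1)
  proof (induction rule: converse_rtrancl_induct)
    case base
    then show ?case using assms(3) by (auto intro!: exI[of _ "[]"] simp: awalk_Nil_iff)
  next
    case (step u w)
    then obtain p where "awalk w p v" "set p \<subseteq> R" by blast
    then show ?case
      using step.hyps assms(2) by (intro exI[of _ "(u, w) # p"]) (auto simp: awalk_Cons_iff)
  qed
  then show ?thesis
    using apath_awalk_to_apath awalk_to_apath_subset that by blast
qed

lemma (in pair_wf_digraph) apath_arc_verts:
  assumes "apath u p v" "(a, b) \<in> set p"
  shows "a \<noteq> v" "a \<in> set (pawalk_verts u p)" "b \<in> set (pawalk_verts u p)"
proof -
  show "a \<noteq> v"
    using assms
  proof (induction p arbitrary: u)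
    case (Cons e p)
    then show ?case
      using apath_nonempty_ends[of u "e # p" v] by (auto simp: apath_Cons_iff)
  qed simp
  have "(a, b) \<in> set p \<Longrightarrow> pcas u p v \<Longrightarrow> a \<in> set (pawalk_verts u p) \<and> b \<in> set (pawalk_verts u p)"
    by (induction p arbitrary: u) (case_tac p; fastforce)+
  then show "a \<in> set (pawalk_verts u p)" "b \<in> set (pawalk_verts u p)"
    using assms by (auto simp: apath_def awalk_def)
qed

lemma (in pair_wf_digraph) reachable_iff_rtrancl:
  "reachable (with_proj G) u v \<longleftrightarrow> u \<in> pverts G \<and> v \<in> pverts G \<and> (u, v) \<in> (parcs G)\<^sup>*"
proof
  assume *: "reachable (with_proj G) u v"
  then obtain p where p: "apath u p v" using reachable_apath by blast
  then have "set p \<subseteq> parcs G" by (auto simp: apath_def awalk_def)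
  with p show "u \<in> pverts G \<and> v \<in> pverts G \<and> (u, v) \<in> (parcs G)\<^sup>*"
    using apath_reachable[OF p] awalk_hd_in_verts[OF awalkI_apath[OF p]]
      awalk_last_in_verts[OF awalkI_apath[OF p]] by simp
next
  assume "u \<in> pverts G \<and> v \<in> pverts G \<and> (u, v) \<in> (parcs G)\<^sup>*"
  then show "reachable (with_proj G) u v"
    using reachable_apath_subset[of u v "parcs G"] reachable_apath by (metis order_refl)
qed

text \<open>Connectedness is defined through the symmetric closure, which here is the graph
  itself.\<close>

lemma (in pair_sym_digraph) connected_iff_rtrancl:
  "Digraph_Component.connected (with_proj G) \<longleftrightarrow>
     pverts G \<noteq> {} \<and> (\<forall>u\<in>pverts G. \<forall>v\<in>pverts G. (u, v) \<in> (parcs G)\<^sup>*)"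
proof -
  have "parcs (mk_symmetric (with_proj G)) = parcs G"
    using arcs_symmetric by (auto simp: parcs_mk_symmetric)
  then have "mk_symmetric (with_proj G) = G"
    by simp
  then show ?thesis
    by (simp add: Digraph_Component.connected_def strongly_connected_def reachable_iff_rtrancl)
qed

lemma (in pair_sym_digraph) sym_parcs: "sym (parcs G)"
  using arcs_symmetric by (auto simp: sym_def)

lemma (in edge_tree) pair_graph_edges:
  assumes "finite V"
  shows "pair_graph \<lparr>pverts = V, parcs = E\<rparr>"
proof
  show "e \<in> parcs \<lparr>pverts = V, parcs = E\<rparr> \<Longrightarrow> fst e \<noteq> snd e" for e
    using bridge by (cases e) auto
qed (use edges_subset sym_edges assms finite_edges in \<open>auto simp: symmetric_def\<close>)

section \<open>Equivalence of the two notions of tree\<close>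

lemma edge_tree_if_undirected_tree:
  assumes "undirected_tree T"
  shows "edge_tree (pverts T) (parcs T)"
proof -
  interpret pair_graph T using assms by (simp add: undirected_tree_def)
  show ?thesis
  proof
    show "parcs T \<subseteq> pverts T \<times> pverts T" using wellformed' by auto
    show "sym (parcs T)" by (rule sym_parcs)
    show "(u, v) \<in> (parcs T)\<^sup>*" if "u \<in> pverts T" "v \<in> pverts T" for u v
      using assms that connected_iff_rtrancl by (simp add: undirected_tree_def)
    show "(u, v) \<notin> (delete_edge (parcs T) u v)\<^sup>*" if uv: "(u, v) \<in> parcs T" for u v
    proof
      assume "(u, v) \<in> (delete_edge (parcs T) u v)\<^sup>*"
      then obtain p where p: "apath u p v" "set p \<subseteq> delete_edge (parcs T) u v"
        using reachable_apath_subset[of u v "delete_edge (parcs T) u v"] wellformed' uv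
        by (auto simp: delete_edge_def)
      have "u \<noteq> v" using uv no_loops' by blast
      \<comment> \<open>A path with a single arc would be the cut edge itself. Closing
        \<open>p\<close> with \<open>(v, u)\<close> hence gives a cycle of length at least
        3.\<close>
      with p have "2 \<le> length p"
        by (cases p; cases "tl p") (auto simp: apath_simps delete_edge_def)
      moreover have "cycle ((v, u) # p)"
        unfolding cycle_def using p(1) arcs_symmetric[OF uv]
        by (intro exI[of _ v]) (auto simp: apath_def awalk_Cons_iff)
      ultimately show False
        using assms by (force simp: undirected_tree_def)
    qed
  qed
qed

text \<open>Without its first arc \<open>(u, v)\<close>, a cycle of length at least 3 is a path from
  \<open>v\<close> back to \<open>u\<close> that avoids {u, v}, so {u, v} is not a bridge.\<close>

lemma undirected_tree_if_edge_tree: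
  assumes "edge_tree V E" "finite V" "V \<noteq> {}"
  shows "undirected_tree \<lparr>pverts = V, parcs = E\<rparr>"
proof -
  let ?T = "\<lparr>pverts = V, parcs = E\<rparr>"
  interpret edge_tree V E by fact
  interpret T: pair_graph ?T using pair_graph_edges assms(2) .
  have "\<not> T.cycle p" if len: "3 \<le> length p" for p
  proof
    assume "T.cycle p"
    then obtain a where a: "T.awalk a p a" "distinct (tl (pawalk_verts a p))"
      by (auto simp: T.cycle_def)
    obtain u v q where p: "p = (u, v) # q" using len by (cases p) auto
    have q: "T.apath v q u" and uv: "(u, v) \<in> E"
      using a by (auto simp: p T.apath_def T.awalk_Cons_iff)
    have "(u, v) \<notin> set q" using T.apath_arc_verts[OF q] by blast
    moreover have "(v, u) \<notin> set q"
    proof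
      \<comment> \<open>The path \<open>q\<close> visits \<open>v\<close> only at its start, so
        \<open>(v, u)\<close> would be its first arc and, as \<open>q\<close> ends at
        \<open>u\<close>, its only one. The cycle would then have length 2.\<close>
      assume vu: "(v, u) \<in> set q"
      obtain w q' where q': "q = (v, w) # q'"
        using q vu by (cases q) (auto simp: T.apath_Cons_iff)
      with q have "T.apath w q' u" "v \<notin> set (pawalk_verts w q')"
        by (auto simp: T.apath_Cons_iff)
      then have "w = u"
        using vu q' T.apath_arc_verts(2) by auto
      with \<open>T.apath w q' u\<close> have "q' = []" using T.apath_nonempty_ends by blast
      with len show False by (simp add: p q')
    qed
    moreover have "set q \<subseteq> E" using q by (auto simp: T.apath_def T.awalk_def)
    ultimately have "(v, u) \<in> (delete_edge E u v)\<^sup>*"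
      by (intro T.apath_reachable[OF q]) (auto simp: delete_edge_def)
    then show False
      using bridge[OF edge_reverse[OF uv]] by (simp add: delete_edge_swap)
  qed
  moreover have "Digraph_Component.connected (with_proj ?T)"
    using assms(3) edges_connected by (subst T.connected_iff_rtrancl) auto
  ultimately show ?thesis
    using T.pair_graph by (auto simp: undirected_tree_def)
qed

text \<open>Spanning fixes the vertex set, so a tree is determined by its arcs. Nonemptiness enters
  because a connected graph has a vertex by definition, while \<open>edge_tree\<close> allows
  none.\<close>

lemma spanning_trees_eq:
  assumes "pair_graph G" "pverts G \<noteq> {}"
  shows "spanning_trees G =
    (\<lambda>E. \<lparr>pverts = pverts G, parcs = E\<rparr>) ` edge_trees (pverts G) (parcs G)"
proof -
  interpret pair_graph G by fact
  have "T \<in> (\<lambda>E. \<lparr>pverts = pverts G, parcs = E\<rparr>) ` edge_trees (pverts G) (parcs G)"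
    if "T \<in> spanning_trees G" for T
    using that edge_tree_if_undirected_tree[of T]
    by (intro image_eqI[of _ _ "parcs T"])
       (auto simp: spanning_trees_def spanning_def subgraph_def edge_trees_def)
  moreover have "\<lparr>pverts = pverts G, parcs = E\<rparr> \<in> spanning_trees G"
    if "E \<in> edge_trees (pverts G) (parcs G)" for E
  proof -
    have E: "edge_tree (pverts G) E" "E \<subseteq> parcs G" using that by (auto simp: edge_trees_def)
    interpret T: pair_graph "\<lparr>pverts = pverts G, parcs = E\<rparr>"
      using edge_tree.pair_graph_edges E pair_finite_verts by blast
    show ?thesis
      using undirected_tree_if_edge_tree[OF E(1) pair_finite_verts assms(2)] E(2)
        wf_digraph T.wf_digraph
      by (auto simp: spanning_trees_def spanning_def subgraph_def)
  qed
  ultimately show ?thesis by blast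
qed

section \<open>In-trees, unique paths and path entropy\<close>

context edge_tree
begin

abbreviation T :: "'a pair_pre_digraph" where
  "T \<equiv> \<lparr>pverts = V, parcs = E\<rparr>"

text \<open>A path starting with \<open>(u, v)\<close> never returns to \<open>u\<close>, so its
  remainder avoids {u, v}. Conversely, a path from \<open>v\<close> that avoids this bridge cannot
  meet \<open>u\<close>, so \<open>(u, v)\<close> can be put in front.\<close>

lemma in_tree_eq_arcs_towards:
  assumes "finite V" "x \<in> V"
  shows "in_tree T x = arcs_towards E x"
proof -
  interpret T: pair_graph T using pair_graph_edges assms(1) .
  have "(\<exists>p. T.apath u ((u, v) # p) x) \<longleftrightarrow> (v, x) \<in> (delete_edge E u v)\<^sup>*"
    if uv: "(u, v) \<in> E" for u v
  proof
    assume "\<exists>p. T.apath u ((u, v) # p) x"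
    then obtain p where p: "T.apath v p x" "u \<notin> set (pawalk_verts v p)"
      by (auto simp: T.apath_Cons_iff)
    have "set p \<subseteq> E" using p(1) by (auto simp: T.apath_def T.awalk_def)
    then have "set p \<subseteq> delete_edge E u v"
      using T.apath_arc_verts(2,3)[OF p(1)] p(2) by (auto simp: delete_edge_def)
    then show "(v, x) \<in> (delete_edge E u v)\<^sup>*" by (rule T.apath_reachable[OF p(1)])
  next
    assume "(v, x) \<in> (delete_edge E u v)\<^sup>*"
    then obtain p where p: "T.apath v p x" "set p \<subseteq> delete_edge E u v"
      using T.reachable_apath_subset[of v x "delete_edge E u v"] assms
      by (auto simp: delete_edge_def)
    have "u \<notin> set (pawalk_verts v p)"
    proof
      assume "u \<in> set (pawalk_verts v p)"
      then have "(v, u) \<in> (delete_edge E u v)\<^sup>*"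
        using p T.pcas_verts_reachable by (auto simp: T.apath_def T.awalk_def)
      then show False
        using bridge[OF edge_reverse[OF uv]] by (simp add: delete_edge_swap)
    qed
    then show "\<exists>p. T.apath u ((u, v) # p) x"
      using p uv by (auto simp: T.apath_Cons_iff)
  qed
  then show ?thesis by (auto simp: in_tree_def arcs_towards_def)
qed

text \<open>The first arcs of both paths are the unique arc towards \<open>x\<close>; induction does
  the rest. This justifies the description in \<open>tree_path\<close>.\<close>

lemma apath_unique:
  assumes "finite V" "pre_digraph.apath (with_proj T) y p x" "pre_digraph.apath (with_proj T) y q x"
  shows "p = q"
proof -
  interpret T: pair_graph T using pair_graph_edges assms(1) .
  have "x \<in> V" using assms(2) T.awalk_last_in_verts by (auto simp: T.apath_def)
  show ?thesis
    using assms(2,3)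
  proof (induction p arbitrary: y q)
    case Nil
    then show ?case using T.apath_nonempty_ends by (auto simp: T.apath_Nil_iff)
  next
    case (Cons e p)
    then have "y \<noteq> x" using T.apath_nonempty_ends by blast
    with Cons.prems(2) obtain e' q' where q: "q = e' # q'"
      by (cases q) (auto simp: T.apath_Nil_iff)
    obtain v v' where e: "e = (y, v)" "e' = (y, v')"
      using Cons.prems q by (cases e; cases e') (auto simp: T.apath_Cons_iff)
    have "(y, v) \<in> in_tree T x" "(y, v') \<in> in_tree T x"
      using Cons.prems q e by (auto simp: in_tree_def T.apath_Cons_iff)
    then have "v = v'"
      using arc_towards_unique in_tree_eq_arcs_towards[OF assms(1) \<open>x \<in> V\<close>] by simp
    then show ?case
      using Cons q e by (auto simp: T.apath_Cons_iff)
  qed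
qed

text \<open>Moving the root back from \<open>v\<close> to \<open>y\<close> along a path arc
  \<open>(y, v)\<close> multiplies the weight by \<open>k v y / k y v\<close>, the exponential of
  minus the entropy of that arc. The factors telescope along the path.\<close>

lemma exp_tree_entropy:
  assumes "finite V" "x \<in> V" "y \<in> V" and k: "\<And>u v. (u, v) \<in> E \<Longrightarrow> 0 < k u v"
  shows "exp (- tree_entropy k T y x) * arcs_weight k E x = arcs_weight k E y"
proof -
  interpret T: pair_graph T using pair_graph_edges assms(1) .
  obtain p where p: "T.apath y p x"
    using T.reachable_apath_subset[OF edges_connected[OF assms(3,2)]] assms(2) by auto
  then have "tree_path T y x = p"
    unfolding tree_path_def using apath_unique[OF assms(1)] by blast
  moreover have "exp (- (\<Sum>(u, v) \<leftarrow> p. ln (k u v / k v u))) * arcs_weight k E x = arcs_weight k E y"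
    using p
  proof (induction p arbitrary: y)
    case Nil
    then show ?case by (simp add: T.apath_Nil_iff)
  next
    case (Cons e p)
    then obtain v where e: "e = (y, v)" "(y, v) \<in> E" "T.apath v p x"
      by (cases e) (auto simp: T.apath_Cons_iff)
    have pos: "0 < k y v" "0 < k v y" using k e(2) edge_reverse by blast+
    have "exp (- ln (k y v / k v y)) = k v y / k y v"
      using pos by (simp add: exp_minus)
    moreover have "k v y * arcs_weight k E v = k y v * arcs_weight k E y"
      using weight_adjacent assms(1) e(2) .
    ultimately show ?case
      using Cons.IH[OF e(3)] pos by (simp add: e(1) exp_add exp_diff exp_minus field_simps)
  qed
  ultimately show ?thesis by (simp add: tree_entropy_def)
qed

end

section \<open>Comparison of the stationary distribution with the tree weights\<close>

theorem mainTheorem1: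
  fixes G :: "'a pair_pre_digraph"
    and \<psi> S :: "'a \<Rightarrow> 'a \<Rightarrow> real"
    and k :: "'a \<Rightarrow> 'a \<Rightarrow> real"
    and \<rho> :: "'a \<Rightarrow> real"
    and x :: 'a
  assumes "pair_graph G"
    and "Digraph_Component.connected (with_proj G)"
    and "\<And>u v. u \<in> pverts G \<Longrightarrow> v \<in> pverts G \<Longrightarrow> \<psi> u v = \<psi> v u"
    and "\<And>u v. u \<in> pverts G \<Longrightarrow> v \<in> pverts G \<Longrightarrow> 0 \<le> \<psi> u v"
    and "\<And>u v. u \<in> pverts G \<Longrightarrow> v \<in> pverts G \<Longrightarrow> \<psi> u v \<noteq> 0 \<longleftrightarrow> (u, v) \<in> parcs G"
    and "\<And>u v. u \<in> pverts G \<Longrightarrow> v \<in> pverts G \<Longrightarrow> S u v = - S v u"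
    and "k = jump_rate \<psi> S"
    and "stationary_distribution (pverts G) k \<rho>"
    and "x \<in> pverts G"
  shows "1 / \<rho> x = (\<Sum>y \<in> pverts G. tree_expectation k G x (\<lambda>T. exp (- tree_entropy k T y x)))"
proof -
  interpret G: pair_graph G by fact
  define V A where "V = pverts G" and "A = parcs G"
  define w where "w = root_weight k V A"
  define graph where "graph E = \<lparr>pverts = V, parcs = E\<rparr>" for E :: "('a \<times> 'a) set"
  note fin = G.pair_finite_verts[folded V_def]
  have x: "x \<in> V" using assms(9) by (simp add: V_def)
  then have "V \<noteq> {}" by blast
  have A: "A \<subseteq> V \<times> V" "sym A"
    using G.wellformed' G.sym_parcs by (auto simp: A_def V_def)
  have "irrefl A"
    unfolding A_def irrefl_def using G.no_loops' by blast
  have conn: "(u, v) \<in> A\<^sup>*" if "u \<in> V" "v \<in> V" for u v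
    using assms(2) that by (simp add: G.connected_iff_rtrancl A_def V_def)
  have k_pos: "0 < k u v" if "(u, v) \<in> A" for u v
    using assms(4,5)[of u v] that A(1) by (force simp: assms(7) jump_rate_def A_def V_def)
  have k_zero: "k u v = 0" if "u \<in> V" "v \<in> V" "(u, v) \<notin> A" for u v
    using assms(5)[of u v] that by (simp add: assms(7) jump_rate_def A_def V_def)
  have w_pos: "0 < w y" for y
    unfolding w_def by (rule root_weight_pos[OF fin A conn k_pos])
  have trees: "spanning_trees G = graph ` edge_trees V A"
    using spanning_trees_eq[OF assms(1)] assms(9) by (auto simp: V_def A_def graph_def)
  have inj: "inj_on graph (edge_trees V A)"
    by (auto simp: inj_on_def graph_def)
  have weight: "tree_weight k (graph E) y = arcs_weight k E y" if "E \<in> edge_trees V A" "y \<in> V" for E y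
    using that edge_tree.in_tree_eq_arcs_towards[of V E y] fin
    by (simp add: tree_weight_def arcs_weight_def edge_trees_def graph_def)
  have total: "total_tree_weight k G x = w x"
    using weight x
    by (simp add: total_tree_weight_def trees sum.reindex[OF inj] w_def root_weight_def)
  have expectation: "tree_expectation k G x (\<lambda>T. exp (- tree_entropy k T y x)) = w y / w x"
    if "y \<in> V" for y
  proof -
    have "exp (- tree_entropy k (graph E) y x) * tree_weight k (graph E) x = arcs_weight k E y"
      if E: "E \<in> edge_trees V A" for E
    proof -
      interpret edge_tree V E using E by (simp add: edge_trees_def)
      have "0 < k u v" if "(u, v) \<in> E" for u v
        using that E k_pos by (auto simp: edge_trees_def)
      then show ?thesis
        using exp_tree_entropy[OF fin x \<open>y \<in> V\<close>, of k] weight[OF E x]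
        by (simp add: graph_def)
    qed
    then show ?thesis
      by (simp add: tree_expectation_def total trees sum.reindex[OF inj] w_def root_weight_def)
  qed
  have balance_w: "(\<Sum>v | (u, v) \<in> A. k v u * w v) = (\<Sum>v | (u, v) \<in> A. k u v * w u)"
    if "u \<in> V" for u
    unfolding w_def by (rule markov_chain_tree[OF fin A \<open>irrefl A\<close> that])
  have balance_\<rho>: "(\<Sum>v | (u, v) \<in> A. k v u * \<rho> v) = (\<Sum>v | (u, v) \<in> A. k u v * \<rho> u)"
    if u: "u \<in> V" for u
  proof -
    \<comment> \<open>Between vertices that are not adjacent both rates vanish, so stationarity over
      \<open>V\<close> is a balance over the neighbours.\<close>
    have "(\<Sum>v | (u, v) \<in> A. k u v * \<rho> u - k v u * \<rho> v) = (\<Sum>v\<in>V. k u v * \<rho> u - k v u * \<rho> v)"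
    proof (rule sum.mono_neutral_left[OF fin])
      show "{v. (u, v) \<in> A} \<subseteq> V" using A(1) by blast
      show "\<forall>v\<in>V - {v. (u, v) \<in> A}. k u v * \<rho> u - k v u * \<rho> v = 0"
        using k_zero u A(2) by (auto dest: symD)
    qed
    also have "\<dots> = 0"
      using assms(8) u by (simp add: stationary_distribution_def V_def)
    finally show ?thesis by (simp add: sum_subtractf)
  qed
  obtain c where c: "\<And>y. y \<in> V \<Longrightarrow> \<rho> y = c * w y"
    using stationary_unique[OF fin \<open>V \<noteq> {}\<close> A conn k_pos w_pos balance_w balance_\<rho>] by blast
  have "1 = (\<Sum>y\<in>V. \<rho> y)"
    using assms(8) by (simp add: stationary_distribution_def V_def)
  also have "\<dots> = c * (\<Sum>y\<in>V. w y)"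
    using c by (simp add: sum_distrib_left)
  finally have norm: "c * (\<Sum>y\<in>V. w y) = 1" by simp
  \<comment> \<open>Normalization makes \<open>c\<close> nonzero, so
    \<open>\<rho> x = c * w x\<close> can be inverted.\<close>
  then have "c \<noteq> 0" by auto
  then have "1 / \<rho> x = (\<Sum>y\<in>V. w y) / w x"
    using norm c[OF x] w_pos[of x] by (simp add: field_simps)
  also have "\<dots> = (\<Sum>y\<in>V. tree_expectation k G x (\<lambda>T. exp (- tree_entropy k T y x)))"
    by (simp add: expectation sum_divide_distrib)
  finally show ?thesis by (simp add: V_def)
qed

end
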